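(* Let $w \in S_n$ be a permutation that avoids the patterns $1432$ and $1423$, and let $u$ be a subword of $w$. Then \[ \sum_{u \le v \le w} (-1)^{|w|-|v|}\, M_{w,v}\, \mathfrak{S}_{\mathrm{perm}(v)}(\mathbf{x}_{w^{-1}(v)}) \in \mathbb{Z}_{\ge 0}[x_1,\dots,x_n], \qquad\text{where } M_{w,v} := \prod_{(i,j) \in D(w)\setminus \widehat{D(w)}_v} x_i , \] and the sum ranges over all words $v$ such that $u$ is a subword of $v$ and $v$ is a subword of $w$.
   Context: Permutations $w\in S_n$ are written in one-line notation $w=w(1)\cdots w(n)$ and regarded as words; $|v|$ is the length of a word $v$. For words $u,v$, $u\le v$ means $u$ is a subword of $v$, i.e. $u=v(i_1)\cdots v(i_{|u|})$ for some $1\le i_1<\dots<i_{|u|}\le |v|$ (the empty word is a subword of every word). A permutation $w$ avoids a pattern $\pi\in S_k$ if no subword of $w$ of length $k$ has its letters in the same relative order as $\pi$. For a word $v$ with distinct letters, $\mathrm{perm}(v)\in S_{|v|}$ is the permutation whose entries have the same relative order as the letters of $v$ (replace the smallest letter by $1$, the next by $2$, etc.). For a subword $v$ of $w\in S_n$, $\mathbf{x}_{w^{-1}(v)} := (x_{w^{-1}(v(1))},\dots,x_{w^{-1}(v(|v|))})$, and $\mathfrak{S}_\pi(\mathbf{x}_{w^{-1}(v)})$ denotes the Schubert polynomial $\mathfrak{S}_\pi(y_1,\dots,y_{|v|})$ with $y_t$ replaced by the $t$-th entry of this tuple. The Rothe diagram of $w\in S_n$ is $D(w)=\{(i,j)\in[n]\times[n]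 : i<w^{-1}(j),\ j<w(i)\}$ (box $(i,j)$ is in row $i$, column $j$). For a subword $v\le w$, $\widehat{D(w)}_v$ is the set of boxes $(i,j)\in D(w)$ with $i\in\{w^{-1}(v(1)),\dots,w^{-1}(v(|v|))\}$ and $j\in\{v(1),\dots,v(|v|)\}$. *)

theory Defs
  imports
    "HOL-Library.Poly_Mapping"
    "HOL-Library.Sublist"
    "HOL-Combinatorics.Multiset_Permutations"
    "HOL-Combinatorics.Transposition"
begin

section \<open>Integer polynomials in the variables \<open>x\<^sub>0, x\<^sub>1, x\<^sub>2, \<dots>\<close>\<close>

text \<open>
  A monomial is a finitely supported exponent function, and a polynomial a finitely
  supported function from monomials to coefficients; the ring structure is the
  convolution product of \<^theory>\<open>HOL-Library.Poly_Mapping\<close>.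
  Only variables with index at least \<open>1\<close> occur in Schubert polynomials.
\<close>

type_synonym mpoly = "(nat \<Rightarrow>\<^sub>0 nat) \<Rightarrow>\<^sub>0 int"

definition Var :: "nat \<Rightarrow> mpoly" where
  "Var i = Poly_Mapping.single (Poly_Mapping.single i 1) 1"

definition subst :: "(nat \<Rightarrow> mpoly) \<Rightarrow> mpoly \<Rightarrow> mpoly" where
  "subst \<sigma> p =
     (\<Sum>m\<in>Poly_Mapping.keys p.
        of_int (Poly_Mapping.lookup p m) *
        (\<Prod>i\<in>Poly_Mapping.keys m. \<sigma> i ^ Poly_Mapping.lookup m i))"

definition nonneg_polys :: "nat \<Rightarrow> mpoly set" where
  "nonneg_polys n =
     {p. (\<forall>m. Poly_Mapping.lookup p m \<ge> 0) \<and>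
         (\<forall>m\<in>Poly_Mapping.keys p. Poly_Mapping.keys m \<subseteq> {1..n})}"


section \<open>Permutations as words\<close>

text \<open>
  \<open>S\<^sub>n\<close> in one-line notation is \<open>permutations_of_set {1..n}\<close>, and the subword relation is
  \<^const>\<open>subseq\<close>. Letters and positions are counted from \<open>1\<close>, hence the shift in
  \<open>entry\<close>, which denotes \<open>w(i)\<close>; \<open>pos w a\<close> denotes \<open>w\<^sup>-\<^sup>1(a)\<close>.
\<close>

definition entry :: "nat list \<Rightarrow> nat \<Rightarrow> nat" where
  "entry w i = w ! (i - 1)"

definition pos :: "nat list \<Rightarrow> nat \<Rightarrow> nat" where
  "pos w a = inv_into {1..length w} (entry w) a"

definition same_relative_order :: "nat list \<Rightarrow> nat list \<Rightarrow> bool" where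
  "same_relative_order v p \<longleftrightarrow>
     length v = length p \<and>
     (\<forall>i<length p. \<forall>j<length p. v ! i < v ! j \<longleftrightarrow> p ! i < p ! j)"

definition avoids :: "nat list \<Rightarrow> nat list \<Rightarrow> bool" where
  "avoids w p \<longleftrightarrow> \<not> (\<exists>v. subseq v w \<and> same_relative_order v p)"

definition perm :: "nat list \<Rightarrow> nat list" where
  "perm v = map (\<lambda>a. card {b \<in> set v. b \<le> a}) v"

definition rothe_diagram :: "nat list \<Rightarrow> (nat \<times> nat) set" where
  "rothe_diagram w =
     {(i, j). i \<in> {1..length w} \<and> j \<in> {1..length w} \<and> i < pos w j \<and> j < entry w i}"

definition rothe_restrict :: "nat list \<Rightarrow> nat list \<Rightarrow> (nat \<times> nat) set" where
  "rothe_restrict w v = {(i, j) \<in> rothe_diagram w. i \<in> pos w ` set v \<and> j \<in> set v}"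


section \<open>Schubert polynomials\<close>

text \<open>
  The difference quotient is a polynomial, since \<open>x\<^sub>i - x\<^bsub>i+1\<^esub>\<close> divides every
  \<open>f - s\<^sub>i f\<close>, and it is unique because \<^typ>\<open>mpoly\<close> is an integral domain.
\<close>

definition divided_diff :: "nat \<Rightarrow> mpoly \<Rightarrow> mpoly" where
  "divided_diff i f =
     (THE g. (Var i - Var (Suc i)) * g = f - subst (\<lambda>j. Var (transpose i (Suc i) j)) f)"

text \<open>The one-line notation of \<open>w s\<^sub>i\<close>, where \<open>s\<^sub>i = (i i+1)\<close>.\<close>

definition swap_at :: "nat list \<Rightarrow> nat \<Rightarrow> nat list" where
  "swap_at w i = w[i - 1 := entry w (Suc i), i := entry w i]"

definition ascent :: "nat list \<Rightarrow> nat \<Rightarrow> bool" where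
  "ascent w i \<longleftrightarrow> 1 \<le> i \<and> i < length w \<and> entry w i < entry w (Suc i)"

lemma swap_at_decreases:
  assumes "ascent w i"
  shows "(\<Sum>k<length (swap_at w i). k * swap_at w i ! k) < (\<Sum>k<length w. k * w ! k)"
proof -
  obtain j where i: "i = Suc j" using assms by (cases i) (auto simp: ascent_def)
  define v where "v = swap_at w i"
  have j: "Suc j < length w" and lt: "w ! j < w ! Suc j"
    using assms by (auto simp: ascent_def entry_def i)
  have v: "length v = length w" "v ! j = w ! Suc j" "v ! Suc j = w ! j"
    "\<And>k. k \<noteq> j \<Longrightarrow> k \<noteq> Suc j \<Longrightarrow> v ! k = w ! k"
    using j by (auto simp: v_def swap_at_def i entry_def)
  let ?A = "{..<length w} - {j} - {Suc j}"
  have split: "(\<Sum>k<length w. f k) = f j + (f (Suc j) + sum f ?A)" for f :: "nat \<Rightarrow> nat"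
    using j by (subst sum.remove[of _ j], simp, simp, subst sum.remove[of _ "Suc j"]) auto
  have eq: "(\<Sum>k\<in>?A. k * v ! k) = (\<Sum>k\<in>?A. k * w ! k)"
    by (rule sum.cong) (auto simp: v)
  show ?thesis
    unfolding v_def[symmetric] v(1) split[of "\<lambda>k. k * v ! k"] split[of "\<lambda>k. k * w ! k"] eq v(2,3)
    using lt by simp
qed

text \<open>
  If \<open>w(i) < w(i+1)\<close>, the Schubert polynomial of \<open>w\<close> is the \<open>i\<close>-th divided difference of that
  of \<open>w s\<^sub>i\<close>. As usual the result does not depend on the choice of the ascent \<open>i\<close>; here the
  first one is taken. In \<open>S\<^sub>n\<close> only the longest element \<open>n (n-1) \<dots> 1\<close> has no ascent.
\<close>

function schubert :: "nat list \<Rightarrow> mpoly" where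
  "schubert w =
     (if \<exists>i. ascent w i
      then divided_diff (LEAST i. ascent w i) (schubert (swap_at w (LEAST i. ascent w i)))
      else (\<Prod>i=1..length w. Var i ^ (length w - i)))"
  by auto
termination
  by (relation "measure (\<lambda>w. \<Sum>k<length w. k * w ! k)")
    (auto intro: swap_at_decreases LeastI)

declare schubert.simps [simp del]

text \<open>\<open>\<SS>\<^bsub>perm v\<^esub>\<close> with its \<open>t\<close>-th variable replaced by \<open>x\<close> with index \<open>w\<^sup>-\<^sup>1(v(t))\<close>.\<close>

definition schubert_subword :: "nat list \<Rightarrow> nat list \<Rightarrow> mpoly" where
  "schubert_subword w v = subst (\<lambda>t. Var (pos w (entry v t))) (schubert (perm v))"

text \<open>The monomial \<open>M\<^bsub>w,v\<^esub>\<close>: one factor \<open>x\<^sub>i\<close> per box, so repeated rows count with multiplicity.\<close>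

definition cofactor :: "nat list \<Rightarrow> nat list \<Rightarrow> mpoly" where
  "cofactor w v = (\<Prod>(i, j)\<in>rothe_diagram w - rothe_restrict w v. Var i)"

end

(*
  Fan and Guo: for w avoiding 1432 and 1423, the Schubert polynomial of w is the product over the
  columns D_j of the Rothe diagram of the polynomials sum_{C <= D_j} x^C, where C runs over the
  sets of rows below D_j in the Gale order. This follows by induction along the first ascent r of
  w: passing from w s_r to w, all columns but that of the letter w(r) have their rows r and r+1
  exchanged, and pattern avoidance leaves at most one column that is really changed by this, on
  which the divided difference acts as a Demazure operator.

  Hence M_{w,v} S_{perm v} is the generating function of the tuples (C_j) with C_j <= D_j that
  differ from (D_j) only in rows and columns belonging to letters of v. So the alternating sum over
  v counts the tuples for which these letters, together with those of u, are all the letters of w.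
*)

theory Submission
  imports Defs "HOL-Library.FuncSet"
begin


section \<open>Substitution\<close>

definition monom_eval :: "(nat \<Rightarrow> mpoly) \<Rightarrow> (nat \<Rightarrow>\<^sub>0 nat) \<Rightarrow> mpoly" where
  "monom_eval \<sigma> m = (\<Prod>i\<in>Poly_Mapping.keys m. \<sigma> i ^ Poly_Mapping.lookup m i)"

lemma monom_eval_superset:
  assumes "finite A" "Poly_Mapping.keys m \<subseteq> A"
  shows "monom_eval \<sigma> m = (\<Prod>i\<in>A. \<sigma> i ^ Poly_Mapping.lookup m i)"
  unfolding monom_eval_def
  by (rule prod.mono_neutral_left) (use assms in \<open>auto simp: in_keys_iff\<close>)

lemma monom_eval_add: "monom_eval \<sigma> (m + n) = monom_eval \<sigma> m * monom_eval \<sigma> n"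
proof -
  let ?A = "Poly_Mapping.keys m \<union> Poly_Mapping.keys n"
  have "finite ?A" "Poly_Mapping.keys (m + n) \<subseteq> ?A"
    by (simp_all add: keys_add)
  then show ?thesis
    by (simp add: monom_eval_superset[of ?A] lookup_add power_add prod.distrib)
qed

lemma subst_superset:
  assumes "finite A" "Poly_Mapping.keys p \<subseteq> A"
  shows "subst \<sigma> p = (\<Sum>m\<in>A. of_int (Poly_Mapping.lookup p m) * monom_eval \<sigma> m)"
  unfolding subst_def monom_eval_def
  by (rule sum.mono_neutral_left) (use assms in \<open>auto simp: in_keys_iff\<close>)

lemma subst_zero [simp]: "subst \<sigma> 0 = 0"
  by (simp add: subst_def)

lemma subst_add: "subst \<sigma> (p + q) = subst \<sigma> p + subst \<sigma> q"
proof -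
  let ?A = "Poly_Mapping.keys p \<union> Poly_Mapping.keys q"
  have "finite ?A" "Poly_Mapping.keys (p + q) \<subseteq> ?A"
    by (simp_all add: keys_add)
  then show ?thesis
    by (simp add: subst_superset[of ?A] lookup_add ring_distribs sum.distrib)
qed

lemma subst_single: "subst \<sigma> (Poly_Mapping.single m c) = of_int c * monom_eval \<sigma> m"
  by (subst subst_superset[of "{m}"]) auto

text \<open>Once \<open>subst\<close> is additive, this induction, applied to each factor in turn,
  reduces its multiplicativity to a product of two terms.\<close>

lemma mpoly_induct [case_names single add]:
  assumes single: "\<And>m c. P (Poly_Mapping.single m c)"
    and add: "\<And>p q. P p \<Longrightarrow> P q \<Longrightarrow> P (p + q)"
  shows "P (p :: mpoly)"
proof (induction p rule: update_induct)
  case const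
  \<comment> \<open>Zero is the term with coefficient 0, whatever its monomial.\<close>
  show ?case using single[of undefined 0] by simp
next
  case (update p m c)
  have "Poly_Mapping.update m c p = p + Poly_Mapping.single m c"
    using update(1) by (intro poly_mapping_eqI) (auto simp: lookup_update lookup_add lookup_single in_keys_iff when_def)
  with update(3) single add show ?case by simp
qed

lemma subst_mult: "subst \<sigma> (p * q) = subst \<sigma> p * subst \<sigma> q"
proof (induction p rule: mpoly_induct)
  case (single m c)
  show ?case
  proof (induction q rule: mpoly_induct)
    case (single m' c')
    show ?case by (simp add: mult_single subst_single monom_eval_add)
  qed (simp add: ring_distribs subst_add)
qed (simp add: ring_distribs subst_add)

lemma subst_one [simp]: "subst \<sigma> 1 = 1"
  using subst_single[of \<sigma> 0 1] by (simp add: monom_eval_def)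

lemma subst_Var [simp]: "subst \<sigma> (Var i) = \<sigma> i"
  by (simp add: Var_def subst_single monom_eval_def)

lemma subst_sum: "subst \<sigma> (\<Sum>a\<in>A. f a) = (\<Sum>a\<in>A. subst \<sigma> (f a))"
  by (induction A rule: infinite_finite_induct) (auto simp: subst_add)

lemma subst_prod: "subst \<sigma> (\<Prod>a\<in>A. f a) = (\<Prod>a\<in>A. subst \<sigma> (f a))"
  by (induction A rule: infinite_finite_induct) (auto simp: subst_mult)

lemma Var_eq_iff [simp]: "Var i = Var j \<longleftrightarrow> i = j"
  unfolding Var_def
  by (metis inj_single injD lookup_single_eq lookup_single_not_eq zero_neq_one)

text \<open>Two solutions agree after cancelling the nonzero factor
  \<open>Var i - Var (Suc i)\<close>, so any explicit quotient is the value of the definite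
  description.\<close>

lemma divided_diff_eqI:
  assumes "(Var i - Var (Suc i)) * g = f - subst (\<lambda>j. Var (transpose i (Suc i) j)) f"
  shows "divided_diff i f = g"
  unfolding divided_diff_def
proof (rule the_equality)
  have "Var i - Var (Suc i) \<noteq> 0" by simp
  then show "h = g" if "(Var i - Var (Suc i)) * h = f - subst (\<lambda>j. Var (transpose i (Suc i) j)) f" for h
    using that assms by (metis mult_left_cancel)
qed (fact assms)


section \<open>Column polynomials\<close>

text \<open>The Gale order: for each i, the i-th smallest element of \<open>C\<close> is at most
  that of \<open>D\<close>. Counting below every threshold \<open>k\<close> expresses this without
  listing the sets in increasing order.\<close>

definition gale :: "nat set \<Rightarrow> nat set \<Rightarrow> nat set set" where
  "gale R D = {C. C \<subseteq> R \<and> card C = card D \<and> (\<forall>k. card (D \<inter> {..<k}) \<le> card (C \<inter> {..<k}))}"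

definition column_poly :: "nat set \<Rightarrow> nat set \<Rightarrow> mpoly" where
  "column_poly R D = (\<Sum>C\<in>gale R D. \<Prod>i\<in>C. Var i)"

lemma finite_gale [simp]: "finite R \<Longrightarrow> finite (gale R D)"
  by (rule finite_subset[of _ "Pow R"]) (auto simp: gale_def)

lemma self_in_gale: "D \<subseteq> R \<Longrightarrow> D \<in> gale R D"
  by (simp add: gale_def)

text \<open>Initial segments are minimal in the Gale order: the threshold \<open>Suc m\<close>
  already forces all \<open>m\<close> elements of \<open>C\<close> into the first \<open>m\<close>
  rows.\<close>

lemma gale_initial:
  assumes "m \<le> n"
  shows "gale {1..n} {1..m} = {{1..m}}"
proof (intro equalityI subsetI)
  fix C assume C: "C \<in> gale {1..n} {1..m}"
  then have "card ({1..m} \<inter> {..<Suc m}) \<le> card (C \<inter> {..<Suc m})" "card C = m" "C \<subseteq> {1..n}"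
    by (auto simp: gale_def)
  moreover have "{1..m} \<inter> {..<Suc m} = {1..m}" by auto
  moreover have "C \<inter> {..<Suc m} \<subseteq> {1..m}" using \<open>C \<subseteq> {1..n}\<close> by auto
  ultimately have "C \<inter> {..<Suc m} = {1..m}"
    by (intro card_subset_eq) (auto intro: antisym dest: card_mono[rotated])
  then have "{1..m} \<subseteq> C" by auto
  then have "C = {1..m}"
    using \<open>card C = m\<close> \<open>C \<subseteq> {1..n}\<close> by (metis card_atLeastAtMost card_subset_eq diff_Suc_1 finite_atLeastAtMost finite_subset)
  then show "C \<in> {{1..m}}" by simp
qed (use assms in \<open>auto intro!: self_in_gale\<close>)

section \<open>Exchanging the adjacent rows r and r + 1\<close>

lemma card_Int_lessThan_Suc:
  "finite A \<Longrightarrow> card (A \<inter> {..<Suc k}) = card (A \<inter> {..<k}) + (if k \<in> A then 1 else 0)"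
  by (simp add: lessThan_Suc Int_insert_right)

lemma transpose_image_inside:
  assumes "r \<in> A \<longleftrightarrow> Suc r \<in> A"
  shows "transpose r (Suc r) ` A = A"
  using assms by (auto simp: transpose_def image_iff split: if_splits)

lemma card_transpose_Int:
  assumes "k \<noteq> Suc r"
  shows "card (transpose r (Suc r) ` C \<inter> {..<k}) = card (C \<inter> {..<k})"
proof -
  have "transpose r (Suc r) ` {..<k} = {..<k}"
    by (rule transpose_image_inside) (use assms in auto)
  then have "transpose r (Suc r) ` (C \<inter> {..<k}) = transpose r (Suc r) ` C \<inter> {..<k}"
    by (simp add: image_Int)
  then show ?thesis by (metis card_image inj_on_transpose)
qed

text \<open>Only the count below \<open>Suc r\<close> can change. If \<open>r\<close> is not in
  \<open>D\<close>, the bound at \<open>r\<close> suffices there; if \<open>D\<close> contains both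
  rows, the bound at \<open>r + 2\<close> does, since \<open>r\<close> contributes at most 1 to
  \<open>C\<close>.\<close>

lemma transpose_in_gale:
  assumes R: "finite R" "r \<in> R \<longleftrightarrow> Suc r \<in> R" and D: "finite D" "r \<notin> D \<or> Suc r \<in> D"
    and C: "C \<in> gale R D"
  shows "transpose r (Suc r) ` C \<in> gale R D"
proof -
  let ?t = "transpose r (Suc r)"
  have sub: "C \<subseteq> R" "finite C" and le: "\<And>k. card (D \<inter> {..<k}) \<le> card (C \<inter> {..<k})"
    using C R(1) by (auto simp: gale_def dest: finite_subset)
  have Suc: "r \<in> ?t ` C \<longleftrightarrow> Suc r \<in> C"
    by (auto simp: image_iff transpose_def split: if_splits)
  have "card (?t ` C \<inter> {..<Suc r}) = card (C \<inter> {..<r}) + (if Suc r \<in> C then 1 else 0)"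
    using sub(2) by (simp add: card_Int_lessThan_Suc card_transpose_Int Suc)
  moreover have "card (C \<inter> {..<Suc (Suc r)}) =
      card (C \<inter> {..<r}) + (if r \<in> C then 1 else 0) + (if Suc r \<in> C then 1 else 0)"
    "card (D \<inter> {..<Suc (Suc r)}) =
      card (D \<inter> {..<r}) + (if r \<in> D then 1 else 0) + (if Suc r \<in> D then 1 else 0)"
    "card (D \<inter> {..<Suc r}) = card (D \<inter> {..<r}) + (if r \<in> D then 1 else 0)"
    using sub(2) D(1) by (simp_all add: card_Int_lessThan_Suc)
  ultimately have "card (D \<inter> {..<Suc r}) \<le> card (?t ` C \<inter> {..<Suc r})"
    using D(2) le[of r] le[of "Suc (Suc r)"] by (auto split: if_splits)
  then have "card (D \<inter> {..<k}) \<le> card (?t ` C \<inter> {..<k})" for k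
    by (cases "k = Suc r") (auto simp: card_transpose_Int le)
  moreover have "?t ` C \<subseteq> R"
    using sub(1) transpose_image_inside[OF R(2)] by blast
  moreover have "card (?t ` C) = card C" by (simp add: card_image)
  ultimately show ?thesis using C by (simp add: gale_def)
qed

lemma subst_column_poly:
  "subst (\<lambda>i. Var (f i)) (column_poly R D) = (\<Sum>C\<in>gale R D. \<Prod>i\<in>C. Var (f i))"
  by (simp add: column_poly_def subst_sum subst_prod)

abbreviation swap_vars :: "nat \<Rightarrow> mpoly \<Rightarrow> mpoly" where
  "swap_vars r \<equiv> subst (\<lambda>j. Var (transpose r (Suc r) j))"

text \<open>The exchange of rows is an involution of \<open>gale R D\<close>, so the change of
  variables merely permutes the summands.\<close>

lemma swap_vars_column_poly:
  assumes R: "finite R" "r \<in> R \<longleftrightarrow> Suc r \<in> R" and D: "finite D" "r \<notin> D \<or> Suc r \<in> D"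
  shows "swap_vars r (column_poly R D) = column_poly R D"
  unfolding subst_column_poly unfolding column_poly_def
proof (rule sum.reindex_bij_witness[where i = "image (transpose r (Suc r))" and j = "image (transpose r (Suc r))"])
  fix C assume "C \<in> gale R D"
  then show "transpose r (Suc r) ` C \<in> gale R D" by (rule transpose_in_gale[OF assms])
  show "(\<Prod>i\<in>transpose r (Suc r) ` C. Var i) = (\<Prod>i\<in>C. Var (transpose r (Suc r) i))"
    by (subst prod.reindex) auto
qed (auto simp: image_image transpose_in_gale[OF assms])

text \<open>
  With \<open>q\<close> collecting the sets of \<open>gale R D\<close> that are not in \<open>gale R D'\<close>, deprived of \<open>r + 1\<close>,
  we have \<open>column_poly R D = column_poly R D' + x\<^bsub>r+1\<^esub> q\<close>, where \<open>q\<close> contains neither \<open>x\<^sub>r\<close> nor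
  \<open>x\<^bsub>r+1\<^esub>\<close> and the left-hand side is symmetric in them.
\<close>
lemma column_poly_step:
  assumes R: "finite R" "r \<in> R" "Suc r \<in> R" and D: "finite D" "r \<notin> D" "Suc r \<in> D"
    and D': "D' = transpose r (Suc r) ` D"
  shows "Var r * column_poly R D' - Var (Suc r) * swap_vars r (column_poly R D')
    = (Var r - Var (Suc r)) * column_poly R D"
proof -
  have r: "r \<in> D'" "Suc r \<notin> D'" "finite D'"
    using D by (auto simp: D' image_iff transpose_def split: if_splits)
  have D'k: "card (D' \<inter> {..<k}) = (if k = Suc r then card (D \<inter> {..<r}) + 1 else card (D \<inter> {..<k}))" for k
    using r D by (simp add: card_Int_lessThan_Suc D' card_transpose_Int)
  have Dk: "card (D \<inter> {..<Suc r}) = card (D \<inter> {..<r})" "card (D \<inter> {..<Suc (Suc r)}) = card (D \<inter> {..<r}) + 1"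
    using D by (simp_all add: card_Int_lessThan_Suc)
  have card': "card D' = card D" by (simp add: D' card_image)
  have "card (D \<inter> {..<k}) \<le> card (D' \<inter> {..<k})" for k
    by (simp add: D'k Dk)
  then have sub: "gale R D' \<subseteq> gale R D"
    unfolding gale_def by (auto simp: card' intro: order_trans)
  define N where "N = gale R D - gale R D'"
  \<comment> \<open>Such a \<open>C\<close> violates the bound of \<open>D'\<close> at
    \<open>k = Suc r\<close>, the only threshold where \<open>D\<close> and \<open>D'\<close> have
    different counts. The bounds at \<open>r\<close> and \<open>r + 2\<close> then exclude
    \<open>r\<close> and force \<open>Suc r\<close>.\<close>
  have N: "r \<notin> C \<and> Suc r \<in> C \<and> finite C" if "C \<in> N" for C
  proof -
    have C: "C \<in> gale R D" "C \<notin> gale R D'" using that by (auto simp: N_def)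
    then have fin: "finite C" and le: "\<And>k. card (D \<inter> {..<k}) \<le> card (C \<inter> {..<k})"
      using R(1) by (auto simp: gale_def dest: finite_subset)
    have "\<not> (\<forall>k. card (D' \<inter> {..<k}) \<le> card (C \<inter> {..<k}))"
      using C by (auto simp: gale_def card')
    then have "card (C \<inter> {..<Suc r}) \<le> card (D \<inter> {..<r})"
      using le by (fastforce simp: D'k not_le[symmetric] split: if_splits)
    then show ?thesis
      using le[of r] le[of "Suc (Suc r)"] fin
      by (auto simp: card_Int_lessThan_Suc Dk split: if_splits)
  qed
  define q where "q = (\<Sum>C\<in>N. \<Prod>i\<in>C - {Suc r}. Var i)"
  have "(\<Prod>i\<in>C. Var i) = Var (Suc r) * (\<Prod>i\<in>C - {Suc r}. Var i)" if "C \<in> N" for C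
    using N[OF that] by (simp add: prod.remove)
  then have "(\<Sum>C\<in>N. \<Prod>i\<in>C. Var i) = Var (Suc r) * q"
    by (simp add: q_def sum_distrib_left)
  moreover have "column_poly R D = (\<Sum>C\<in>N. \<Prod>i\<in>C. Var i) + column_poly R D'"
    unfolding column_poly_def N_def using R(1) sub by (intro sum.subset_diff) auto
  ultimately have split: "column_poly R D' = column_poly R D - Var (Suc r) * q"
    by simp
  have "swap_vars r q = q"
    unfolding q_def subst_sum subst_prod subst_Var
    by (intro sum.cong prod.cong refl) (use N in \<open>auto simp: transpose_def\<close>)
  moreover have "swap_vars r (column_poly R D) = column_poly R D"
    by (rule swap_vars_column_poly) (use R D in auto)
  ultimately have "swap_vars r (column_poly R D') + Var r * q = column_poly R D"
    using arg_cong[OF split, of "\<lambda>p. swap_vars r (p + Var (Suc r) * q)"]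
    by (simp add: subst_add subst_mult)
  then have "swap_vars r (column_poly R D') = column_poly R D - Var r * q"
    by (simp add: eq_diff_eq)
  then show ?thesis
    by (simp only: split) (simp add: algebra_simps)
qed


section \<open>Positions and entries\<close>

lemma entry_image: "entry w ` {1..length w} = set w"
proof -
  have "{1..length w} = Suc ` {..<length w}"
    by (simp only: image_Suc_lessThan)
  then show ?thesis by (auto simp: entry_def image_image in_set_conv_nth)
qed

lemma inj_on_entry: "distinct w \<Longrightarrow> inj_on (entry w) {1..length w}"
  by (auto simp: inj_on_def entry_def nth_eq_iff_index_eq)

lemma pos_entry: "distinct w \<Longrightarrow> i \<in> {1..length w} \<Longrightarrow> pos w (entry w i) = i"
  unfolding pos_def by (intro inv_into_f_f inj_on_entry)

lemma entry_pos: "a \<in> set w \<Longrightarrow> entry w (pos w a) = a"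
  unfolding pos_def by (intro f_inv_into_f) (simp only: entry_image)

lemma pos_in: "a \<in> set w \<Longrightarrow> pos w a \<in> {1..length w}"
  unfolding pos_def by (intro inv_into_into) (simp only: entry_image)

lemma entry_in: "i \<in> {1..length w} \<Longrightarrow> entry w i \<in> set w"
  using entry_image by blast

lemma entry_eq_iff:
  "distinct w \<Longrightarrow> i \<in> {1..length w} \<Longrightarrow> k \<in> {1..length w} \<Longrightarrow> entry w i = entry w k \<longleftrightarrow> i = k"
  using inj_on_entry by (metis inj_onD)

lemma map_entry: "map (entry w) [1..<Suc (length w)] = w"
  by (rule nth_equalityI) (auto simp: entry_def nth_upt simp del: upt_Suc)

lemma permutations_of_set_atLeastAtMost:
  assumes "w \<in> permutations_of_set {1..n}"
  shows "length w = n" "distinct w" "set w = {1..n}"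
  using assms length_finite_permutations_of_set[of w "{1..n}"]
  by (auto simp: permutations_of_set_def)

lemma decreasing_before_ascent:
  assumes "distinct w" "\<And>i. i < r \<Longrightarrow> \<not> ascent w i" "r \<le> length w" "1 \<le> i" "i < k" "k \<le> r"
  shows "entry w k < entry w i"
  using assms(5,6)
proof (induction k)
  case (Suc k)
  then have "1 \<le> k" using assms(4) by auto
  then have "\<not> entry w k < entry w (Suc k)"
    using assms(2)[of k] assms(3) Suc.prems by (auto simp: ascent_def)
  moreover have "entry w k \<noteq> entry w (Suc k)"
    using \<open>1 \<le> k\<close> assms(1,3) Suc.prems by (subst entry_eq_iff) auto
  moreover have "k = i \<or> entry w k < entry w i"
    using Suc.IH Suc.prems by (cases "k = i") auto
  ultimately show ?case by auto
qed simp


section \<open>The avoided patterns\<close>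

text \<open>The patterns differ only in the order of their last two letters, so one condition
  leaving these unordered covers both. Positions are used because they are easy to follow through
  \<open>swap_at\<close> and \<open>perm\<close>.\<close>

definition avoids_1432_1423 :: "nat list \<Rightarrow> bool" where
  "avoids_1432_1423 w \<longleftrightarrow>
     (\<forall>p q s t. 1 \<le> p \<and> p < q \<and> q < s \<and> s < t \<and> t \<le> length w \<longrightarrow>
        \<not> (entry w p < entry w s \<and> entry w p < entry w t \<and>
           entry w s < entry w q \<and> entry w t < entry w q))"

lemma avoids_1432_1423I:
  assumes "distinct w" "avoids w [1, 4, 3, 2]" "avoids w [1, 4, 2, 3]"
  shows "avoids_1432_1423 w"
  unfolding avoids_1432_1423_def
proof (intro allI impI notI)
  fix p q s t
  assume pos: "1 \<le> p \<and> p < q \<and> q < s \<and> s < t \<and> t \<le> length w"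
    and pat: "entry w p < entry w s \<and> entry w p < entry w t \<and>
              entry w s < entry w q \<and> entry w t < entry w q"
  let ?v = "[entry w p, entry w q, entry w s, entry w t]"
  have "subseq [p, q, s, t] [1..<Suc (length w)]"
    using pos by (intro sorted_subset_imp_subseq) (auto simp del: upt_Suc)
  then have "subseq ?v w"
    using subseq_map[of "[p, q, s, t]" _ "entry w"] map_entry[of w] by fastforce
  moreover have "entry w s \<noteq> entry w t"
    using pos assms(1) by (subst entry_eq_iff) auto
  then have "same_relative_order ?v [1, 4, 3, 2] \<or> same_relative_order ?v [1, 4, 2, 3]"
    using pat by (auto simp: same_relative_order_def All_less_Suc numeral_eq_Suc)
  ultimately show False using assms(2,3) by (auto simp: avoids_def)
qed


section \<open>Schubert polynomials as products of column polynomials\<close>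

definition column :: "nat list \<Rightarrow> nat \<Rightarrow> nat set" where
  "column w j = {i \<in> {1..length w}. i < pos w j \<and> j < entry w i}"

text \<open>Columns are indexed by the letters in \<open>set w\<close>, so that the product also
  makes sense for a subword that has not been standardized.\<close>

definition column_product :: "nat list \<Rightarrow> mpoly" where
  "column_product w = (\<Prod>j\<in>set w. column_poly {1..length w} (column w j))"

lemma column_poly_initial: "m \<le> n \<Longrightarrow> column_poly {1..n} {1..m} = (\<Prod>i=1..m. Var i)"
  by (simp add: column_poly_def gale_initial del: One_nat_def)

text \<open>The factor \<open>x i\<close> occurs once for each \<open>p\<close> with
  \<open>i < p\<close> and \<open>p <= n\<close>.\<close>

lemma prod_staircase:
  "(\<Prod>p=1..n. \<Prod>i=1..p - 1. x i) = (\<Prod>i=1..n. (x i :: 'a :: comm_monoid_mult) ^ (n - i))"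
proof (induction n)
  case (Suc n)
  have "(\<Prod>i=1..Suc n. x i ^ (Suc n - i)) = (\<Prod>i=1..n. x i ^ (n - i) * x i)"
    by (auto simp: Suc_diff_le power_commutes intro!: prod.cong)
  then show ?case using Suc by (simp add: prod.distrib)
qed simp

text \<open>In a decreasing word the column of the p-th letter consists of all \<open>p - 1\<close>
  earlier rows, an initial segment, so its polynomial is a single monomial.\<close>

lemma column_product_no_ascent:
  assumes w: "w \<in> permutations_of_set {1..n}" and desc: "\<nexists>i. ascent w i"
  shows "column_product w = (\<Prod>i=1..length w. Var i ^ (length w - i))"
proof -
  note n = permutations_of_set_atLeastAtMost[OF w]
  have col: "column w (entry w p) = {1..p - 1}" if "p \<in> {1..n}" for p
  proof -
    have "pos w (entry w p) = p" using that n by (simp add: pos_entry)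
    then show ?thesis
      using that n decreasing_before_ascent[of w n _ p] desc by (fastforce simp: column_def)
  qed
  have "column_product w = (\<Prod>p=1..n. column_poly {1..n} (column w (entry w p)))"
    unfolding column_product_def
    using inj_on_entry[OF n(2)] n(1)
    by (subst entry_image[symmetric], subst prod.reindex) (auto simp: o_def)
  also have "\<dots> = (\<Prod>p=1..n. \<Prod>i=1..p - 1. Var i)"
    by (intro prod.cong refl, subst col, simp, intro column_poly_initial) auto
  also have "\<dots> = (\<Prod>i=1..n. Var i ^ (n - i))"
    by (rule prod_staircase)
  finally show ?thesis using n(1) by simp
qed

section \<open>Passing between w and w s_r\<close>

lemma entry_swap_at:
  assumes "1 \<le> r" "r < length w" "1 \<le> i"
  shows "entry (swap_at w r) i = entry w (transpose r (Suc r) i)"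
  using assms by (auto simp: entry_def swap_at_def transpose_def nth_list_update)

lemma length_swap_at [simp]: "length (swap_at w r) = length w"
  by (simp add: swap_at_def)

lemma swap_at_permutation:
  assumes w: "w \<in> permutations_of_set {1..n}" and r: "1 \<le> r" "r < n"
  shows "swap_at w r \<in> permutations_of_set {1..n}"
proof -
  note n = permutations_of_set_atLeastAtMost[OF w]
  have "set (swap_at w r) = entry (swap_at w r) ` {1..n}"
    using entry_image[of "swap_at w r"] n by simp
  also have "\<dots> = entry w ` transpose r (Suc r) ` {1..n}"
    unfolding image_image by (intro image_cong refl) (use r n in \<open>auto simp: entry_swap_at\<close>)
  also have "\<dots> = {1..n}"
    using r n entry_image[of w] by (subst transpose_image_inside) auto
  finally have "set (swap_at w r) = {1..n}" .
  moreover from this have "distinct (swap_at w r)"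
    by (intro card_distinct) (simp add: n)
  ultimately show ?thesis by (simp add: permutations_of_set_def)
qed

lemma pos_swap_at:
  assumes w: "w \<in> permutations_of_set {1..n}" and r: "1 \<le> r" "r < n" and j: "j \<in> {1..n}"
  shows "pos (swap_at w r) j = transpose r (Suc r) (pos w j)"
proof -
  note n = permutations_of_set_atLeastAtMost[OF w]
  note n' = permutations_of_set_atLeastAtMost[OF swap_at_permutation[OF w r]]
  let ?p = "transpose r (Suc r) (pos w j)"
  have "pos w j \<in> {1..n}" using pos_in[of j w] j n by simp
  then have p: "?p \<in> {1..n}"
    using r by (auto simp: transpose_def)
  then have "entry (swap_at w r) ?p = j"
    using r n j by (auto simp: entry_swap_at entry_pos)
  then show ?thesis using pos_entry[OF n'(2), of ?p] p n' by simp
qed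

text \<open>
  At the first ascent \<open>r\<close> we have \<open>w(1) > \<dots> > w(r)\<close>, so no letter can play the role of the \<open>1\<close>
  in a pattern of \<open>w s\<^sub>r\<close> that uses the new descent.
\<close>
lemma avoids_1432_1423_swap_at:
  assumes w: "w \<in> permutations_of_set {1..n}" and r: "ascent w r" "\<And>i. i < r \<Longrightarrow> \<not> ascent w i"
    and av: "avoids_1432_1423 w"
  shows "avoids_1432_1423 (swap_at w r)"
  unfolding avoids_1432_1423_def
proof (intro allI impI notI)
  note n = permutations_of_set_atLeastAtMost[OF w]
  have r1: "1 \<le> r" "r < n" "entry w r < entry w (Suc r)" using r(1) n by (auto simp: ascent_def)
  let ?t = "transpose r (Suc r)"
  fix p q s t
  assume "1 \<le> p \<and> p < q \<and> q < s \<and> s < t \<and> t \<le> length (swap_at w r)"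
  then have P: "1 \<le> p" "p < q" "q < s" "s < t" "t \<le> n" using n by auto
  assume "entry (swap_at w r) p < entry (swap_at w r) s \<and> entry (swap_at w r) p < entry (swap_at w r) t \<and>
          entry (swap_at w r) s < entry (swap_at w r) q \<and> entry (swap_at w r) t < entry (swap_at w r) q"
  then have pat: "entry w (?t p) < entry w (?t s)" "entry w (?t p) < entry w (?t t)"
       "entry w (?t s) < entry w (?t q)" "entry w (?t t) < entry w (?t q)"
    using P r1 n by (auto simp: entry_swap_at)
  have dec: "entry w r < entry w p" if "p < r"
    using decreasing_before_ascent[OF n(2), of r p r] r(2) P r1 n that by auto
  have mono: "?t a < ?t b" if "a < b" "\<not> (a = r \<and> b = Suc r)" for a b
    using that by (auto simp: transpose_def)
  \<comment> \<open>Only the pair \<open>r\<close>, \<open>Suc r\<close> loses its order under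
    \<open>?t\<close>. Its use as \<open>p\<close>, \<open>q\<close> contradicts the ascent at
    \<open>r\<close>, the other two uses contradict \<open>dec\<close>.\<close>
  have "\<not> (p = r \<and> q = Suc r)" "\<not> (q = r \<and> s = Suc r)" "\<not> (s = r \<and> t = Suc r)"
    using pat P r1 dec by (auto simp: transpose_def split: if_splits)
  then have "?t p < ?t q" "?t q < ?t s" "?t s < ?t t"
    using P mono by blast+
  moreover have "1 \<le> ?t p" "?t t \<le> n" using P r1 by (auto simp: transpose_def)
  ultimately show False
    using av pat n unfolding avoids_1432_1423_def by blast
qed

text \<open>The two products are compared column by column. From \<open>w s_r\<close> to
  \<open>w\<close>, the column of \<open>a = w(r)\<close> loses the factor x_r; columns in
  \<open>L\<close> keep a factor symmetric in x_r and x_(r+1); the set \<open>K\<close> of the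
  others has at most one element, to which \<open>column_poly_step\<close> applies.\<close>

lemma column_product_swap_at:
  assumes w: "w \<in> permutations_of_set {1..n}" and r: "ascent w r" "\<And>i. i < r \<Longrightarrow> \<not> ascent w i"
    and av: "avoids_1432_1423 w"
  shows "(Var r - Var (Suc r)) * column_product w
    = column_product (swap_at w r) - swap_vars r (column_product (swap_at w r))"
proof -
  note n = permutations_of_set_atLeastAtMost[OF w]
  have r1: "1 \<le> r" "r < n" "entry w r < entry w (Suc r)" using r(1) n by (auto simp: ascent_def)
  note n' = permutations_of_set_atLeastAtMost[OF swap_at_permutation[OF w r1(1,2)]]
  define w' where "w' = swap_at w r"
  let ?t = "transpose r (Suc r)"
  define a where "a = entry w r"
  have a: "a \<in> {1..n}" "pos w a = r"
    using r1 n entry_in[of r w] pos_entry[of w r] by (auto simp: a_def)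
  have posI: "pos w j = k \<longleftrightarrow> j = entry w k" if "j \<in> {1..n}" "k \<in> {1..n}" for j k
    using that n pos_entry[of w k] entry_pos[of j w] by auto
  have dec: "a < entry w i" if "1 \<le> i" "i < r" for i
    using decreasing_before_ascent[OF n(2), of r i r] r(2) r1 n that by (auto simp: a_def)
  define R where "R = {1..n}"
  have R: "finite R" "r \<in> R" "Suc r \<in> R" using r1 by (auto simp: R_def)
  have col': "column w' j = ?t ` column w j" if j: "j \<in> {1..n}" "j \<noteq> a" for j
  proof -
    have "i \<in> column w' j \<longleftrightarrow> ?t i \<in> column w j" for i
    proof -
      have "i \<in> {1..n} \<longleftrightarrow> ?t i \<in> {1..n}" using r1 by (auto simp: transpose_def)
      \<comment> \<open>As \<open>pos w j\<close> is not \<open>r\<close>, the sides can differ only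
        for \<open>pos w j = Suc r\<close> and \<open>?t i = r\<close>. Then
        \<open>j = w(r+1)\<close> exceeds \<open>w(r)\<close>, against the proviso.\<close>
      moreover have "i < ?t (pos w j) \<longleftrightarrow> ?t i < pos w j" if "j < entry w (?t i)"
        using that posI[of j r] posI[of j "Suc r"] j r1
        by (auto simp: transpose_def a_def split: if_splits)
      ultimately show ?thesis
        using n j r1 by (auto simp: column_def w'_def pos_swap_at[OF w] entry_swap_at)
    qed
    then show ?thesis by (simp add: set_eq_iff in_transpose_image_iff)
  qed
  \<comment> \<open>A box in row \<open>r\<close> means \<open>j < w(r) < w(r+1)\<close>; hence
    \<open>j\<close> is not \<open>w(r+1)\<close> and stands behind position \<open>Suc r\<close>,
    which gives the box in row \<open>Suc r\<close>.\<close>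
  have cond: "r \<notin> column w j \<or> Suc r \<in> column w j" if j: "j \<in> {1..n}" for j
    using posI[of j "Suc r"] j r1 n by (auto simp: column_def Suc_lessI)
  have fin: "finite (column w j)" for j by (simp add: column_def)
  define K where "K = {j \<in> {1..n} - {a}. r \<notin> column w j \<and> Suc r \<in> column w j}"
  \<comment> \<open>The letters of \<open>K\<close> stand behind position \<open>Suc r\<close> with
    values between \<open>w(r)\<close> and \<open>w(r+1)\<close>. Two of them would complete a
    forbidden pattern with these two letters.\<close>
  have K_le: "j = k" if "j \<in> K" "k \<in> K" for j k
  proof (rule ccontr)
    assume "j \<noteq> k"
    have aux: False if jk: "j \<in> K" "k \<in> K" "pos w j < pos w k" for j k
    proof -
      have *: "Suc r < pos w j" "entry w r < j" "j < entry w (Suc r)" "j \<in> {1..n}"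
              "Suc r < pos w k" "entry w r < k" "k < entry w (Suc r)" "k \<in> {1..n}"
        using jk r1 n by (auto simp: K_def column_def a_def)
      moreover have "pos w k \<le> n" using pos_in[of k w] * n by auto
      ultimately show False
        using av[unfolded avoids_1432_1423_def, rule_format, of r "Suc r" "pos w j" "pos w k"] jk(3) r1 n
        by (simp add: entry_pos)
    qed
    have "pos w j \<noteq> pos w k"
      using \<open>j \<noteq> k\<close> that n entry_pos[of j w] entry_pos[of k w] by (auto simp: K_def)
    then show False using aux that by (meson nat_neq_iff)
  qed
  define F where "F j = column_poly R (column w j)" for j
  define F' where "F' j = column_poly R (column w' j)" for j
  define m :: mpoly where "m = (\<Prod>i=1..r - 1. Var i)"
  have "column w a = {1..r - 1}"
    using dec a r1 n by (auto simp: column_def)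
  then have Fa: "F a = m"
    using r1 by (simp add: F_def R_def m_def column_poly_initial del: One_nat_def)
  \<comment> \<open>In \<open>w'\<close> the letter \<open>a\<close> stands one place later, right
    behind the larger \<open>w(r+1)\<close>, so its column gains row \<open>r\<close>.\<close>
  have "column w' a = {1..r}"
  proof -
    have "pos w' a = Suc r" using a r1 by (simp add: w'_def pos_swap_at[OF w])
    moreover have "a < entry w' i" if "1 \<le> i" "i < Suc r" for i
      using that dec[of i] r1 n by (auto simp: w'_def entry_swap_at transpose_def a_def)
    ultimately show ?thesis using r1 n by (auto simp: column_def w'_def)
  qed
  then have "F' a = (\<Prod>i=1..r. Var i)"
    using r1 by (simp add: F'_def R_def column_poly_initial del: One_nat_def)
  then have Fa': "F' a = m * Var r"
    using r1 by (cases r) (auto simp: m_def mult.commute)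
  have m: "swap_vars r m = m"
    unfolding m_def subst_prod subst_Var by (intro prod.cong refl) (auto simp: transpose_def)
  define L where "L = {1..n} - {a} - K"
  define Q where "Q = (\<Prod>j\<in>L. F j)"
  have swapF: "swap_vars r (F j) = F j" if "j \<in> L" for j
    unfolding F_def by (rule swap_vars_column_poly) (use that R fin cond in \<open>auto simp: L_def\<close>)
  have F_eq: "F' j = F j" if "j \<in> L" for j
  proof -
    have "?t ` column w j = column w j"
      by (rule transpose_image_inside) (use that cond in \<open>auto simp: L_def K_def\<close>)
    then show ?thesis using that by (simp add: F_def F'_def col' L_def)
  qed
  have Q: "(\<Prod>j\<in>L. F' j) = Q" "swap_vars r Q = Q"
    by (auto simp: Q_def F_eq subst_prod swapF)
  define G where "G = (\<Prod>j\<in>K. F j)"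
  define G' where "G' = (\<Prod>j\<in>K. F' j)"
  \<comment> \<open>If \<open>K\<close> is empty both products are 1 and the identity is
    trivial.\<close>
  have G: "Var r * G' - Var (Suc r) * swap_vars r G' = (Var r - Var (Suc r)) * G"
  proof (cases "K = {}")
    case False
    then obtain k where k: "K = {k}" using K_le by blast
    then have "k \<in> K" by simp
    then have "k \<in> {1..n}" "k \<noteq> a" "r \<notin> column w k" "Suc r \<in> column w k"
      by (auto simp: K_def)
    then have "Var r * F' k - Var (Suc r) * swap_vars r (F' k) = (Var r - Var (Suc r)) * F k"
      unfolding F_def F'_def by (intro column_poly_step R fin col')
    with k show ?thesis by (simp add: G_def G'_def)
  qed (simp add: G_def G'_def)
  have split: "(\<Prod>j=1..n. f j) = f a * (\<Prod>j\<in>K. f j) * (\<Prod>j\<in>L. f j)" for f :: "nat \<Rightarrow> mpoly"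
  proof -
    have "(\<Prod>j=1..n. f j) = f a * prod f ({1..n} - {a})"
      using a by (intro prod.remove) auto
    also have "prod f ({1..n} - {a}) = prod f L * prod f K"
      unfolding L_def by (intro prod.subset_diff) (auto simp: K_def)
    finally show ?thesis by (simp add: mult_ac)
  qed
  have P: "column_product w = m * G * Q"
    unfolding column_product_def n using split[of F] by (simp add: F_def R_def Fa[symmetric] G_def Q_def)
  have P': "column_product w' = m * Var r * G' * Q"
    unfolding column_product_def w'_def n' using split[of F'] Q(1) Fa'
    by (simp add: F'_def R_def w'_def G'_def)
  then have swapP': "swap_vars r (column_product w') = m * Var (Suc r) * swap_vars r G' * Q"
    by (simp add: subst_mult m Q)
  have "(Var r - Var (Suc r)) * column_product w = m * Q * ((Var r - Var (Suc r)) * G)"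
    by (simp only: P mult_ac)
  also have "\<dots> = m * Q * (Var r * G' - Var (Suc r) * swap_vars r G')"
    by (simp only: G)
  also have "\<dots> = column_product w' - swap_vars r (column_product w')"
    unfolding swapP' unfolding P' by (simp add: algebra_simps)
  finally show ?thesis unfolding w'_def .
qed

text \<open>The recursion of \<open>schubert\<close> takes the least ascent, exactly where
  \<open>column_product_swap_at\<close> provides the difference quotient and avoidance is inherited
  by \<open>swap_at w r\<close>.\<close>

theorem schubert_eq_column_product:
  assumes "w \<in> permutations_of_set {1..n}" "avoids_1432_1423 w"
  shows "schubert w = column_product w"
  using assms
proof (induction w rule: schubert.induct)
  case (1 w)
  show ?case
  proof (cases "\<exists>i. ascent w i")
    case True
    define r where "r = (LEAST i. ascent w i)"
    have r: "ascent w r" "\<And>i. i < r \<Longrightarrow> \<not> ascent w i"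
      using True by (auto simp: r_def dest: not_less_Least intro: LeastI)
    have len: "1 \<le> r" "r < n"
      using r(1) permutations_of_set_atLeastAtMost[OF 1(2)] by (auto simp: ascent_def)
    have "schubert w = divided_diff r (schubert (swap_at w r))"
      using True by (subst schubert.simps) (simp add: r_def)
    also have "schubert (swap_at w r) = column_product (swap_at w r)"
      using 1(1)[OF True, folded r_def] swap_at_permutation[OF 1(2) len]
        avoids_1432_1423_swap_at[OF 1(2) r 1(3)] by blast
    also have "divided_diff r \<dots> = column_product w"
      by (intro divided_diff_eqI column_product_swap_at[OF 1(2) r 1(3)])
    finally show ?thesis .
  next
    case False
    then show ?thesis
      using column_product_no_ascent[OF 1(2)] by (subst schubert.simps, subst if_not_P) simp_all
  qed
qed


section \<open>Standardization of subwords\<close>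

text \<open>The order-preserving relabelling of letters behind \<open>perm\<close>:
  \<open>perm v = map (rank v) v\<close>.\<close>

definition rank :: "nat list \<Rightarrow> nat \<Rightarrow> nat" where
  "rank v a = card {b \<in> set v. b \<le> a}"

text \<open>Relabelling preserves positions and comparisons of letters, and columns and pattern
  avoidance depend on nothing else.\<close>

lemma column_perm:
  assumes v: "distinct v"
  shows "perm v \<in> permutations_of_set {1..length v}"
    and "bij_betw (rank v) (set v) {1..length v}"
    and "j \<in> set v \<Longrightarrow> column (perm v) (rank v j) = column v j"
    and "avoids_1432_1423 v \<Longrightarrow> avoids_1432_1423 (perm v)"
proof -
  have len: "length (perm v) = length v" by (simp add: perm_def)
  have mono: "rank v a < rank v b" if "a \<in> set v" "b \<in> set v" "a < b" for a b
  proof -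
    have "b \<in> {c \<in> set v. c \<le> b}" "b \<notin> {c \<in> set v. c \<le> a}"
      "{c \<in> set v. c \<le> a} \<subseteq> {c \<in> set v. c \<le> b}"
      using that by auto
    then show ?thesis
      unfolding rank_def by (intro psubset_card_mono) auto
  qed
  then have less_iff: "rank v a < rank v b \<longleftrightarrow> a < b" if "a \<in> set v" "b \<in> set v" for a b
    using that by (metis less_asym linorder_neqE_nat)
  have inj: "inj_on (rank v) (set v)"
    by (rule inj_onI) (metis less_iff nat_neq_iff)
  have "rank v a \<in> {1..length v}" if "a \<in> set v" for a
  proof -
    have "0 < rank v a" unfolding rank_def using that by (auto simp: card_gt_0_iff)
    moreover have "rank v a \<le> card (set v)" unfolding rank_def by (rule card_mono) auto
    ultimately show ?thesis using v by (auto simp: distinct_card)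
  qed
  then have "rank v ` set v \<subseteq> {1..length v}" by blast
  then have im: "rank v ` set v = {1..length v}"
    using inj v by (intro card_subset_eq) (auto simp: card_image distinct_card)
  show bij: "bij_betw (rank v) (set v) {1..length v}"
    using inj im by (simp add: bij_betw_def)
  have perm: "perm v = map (rank v) v" by (simp add: perm_def rank_def)
  show *: "perm v \<in> permutations_of_set {1..length v}"
    using im inj v by (auto simp: perm permutations_of_set_def distinct_map)
  have entry: "entry (perm v) t = rank v (entry v t)" if "t \<in> {1..length v}" for t
    using that by (auto simp: entry_def perm)
  have pos: "pos (perm v) (rank v j) = pos v j" if "j \<in> set v" for j
    using pos_entry[of "perm v" "pos v j"] pos_in[OF that] entry[of "pos v j"] that
      permutations_of_set_atLeastAtMost[OF *] by (simp add: entry_pos)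
  show "column (perm v) (rank v j) = column v j" if "j \<in> set v"
  proof -
    have "rank v j < rank v (entry v i) \<longleftrightarrow> j < entry v i" if "i \<in> {1..length v}" for i
      using that \<open>j \<in> set v\<close> by (intro less_iff entry_in)
    then show ?thesis using that by (auto simp: column_def len pos entry)
  qed
  have "entry (perm v) s < entry (perm v) t \<longleftrightarrow> entry v s < entry v t"
    if "s \<in> {1..length v}" "t \<in> {1..length v}" for s t
    using that by (simp add: entry less_iff entry_in)
  then show "avoids_1432_1423 (perm v)" if "avoids_1432_1423 v"
    using that unfolding avoids_1432_1423_def len by auto
qed

lemma schubert_perm:
  assumes "distinct v" "avoids_1432_1423 v"
  shows "schubert (perm v) = column_product v"
proof -
  note tr = column_perm[OF assms(1)]
  note p = permutations_of_set_atLeastAtMost[OF tr(1)]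
  have "schubert (perm v) = column_product (perm v)"
    using schubert_eq_column_product tr(1,4) assms by blast
  also have "\<dots> = (\<Prod>j\<in>set v. column_poly {1..length v} (column (perm v) (rank v j)))"
    unfolding column_product_def p by (intro prod.reindex_bij_betw[symmetric] tr(2))
  also have "\<dots> = column_product v"
    unfolding column_product_def by (intro prod.cong refl) (simp add: tr(3))
  finally show ?thesis .
qed


section \<open>Restriction of columns\<close>

text \<open>Thresholds in \<open>R\<close> suffice. In this form the Gale order uses only
  comparisons inside \<open>R\<close>, so it can be carried along increasing maps.\<close>

lemma gale_alt:
  assumes "finite R" "D \<subseteq> R"
  shows "gale R D = {C. C \<subseteq> R \<and> card C = card D \<and>
           (\<forall>x\<in>R. card {d \<in> D. d < x} \<le> card {c \<in> C. c < x})}"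
proof -
  have "card (D \<inter> {..<k}) \<le> card (C \<inter> {..<k})"
    if C: "C \<subseteq> R" "card C = card D" and le: "\<forall>x\<in>R. card {d \<in> D. d < x} \<le> card {c \<in> C. c < x}" for C k
  proof (cases "\<exists>x\<in>R. k \<le> x")
    case True
    \<comment> \<open>No element of \<open>R\<close> lies in the gap from \<open>k\<close> up to
      \<open>x\<close>, so counting below \<open>k\<close> and below \<open>x\<close> is the
      same.\<close>
    define x where "x = (LEAST x. x \<in> R \<and> k \<le> x)"
    have x: "x \<in> R \<and> k \<le> x"
      unfolding x_def by (rule LeastI_ex) (use True in blast)
    have "y < k" if "y \<in> R" "y < x" for y
      using not_less_Least[OF that(2)[unfolded x_def]] that(1) by simp
    with x have "A \<inter> {..<k} = {a \<in> A. a < x}" if "A \<subseteq> R" for A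
      using that by (auto simp: subset_iff)
    then show ?thesis using assms C le x by simp
  next
    case False
    then have "A \<inter> {..<k} = A" if "A \<subseteq> R" for A
      using that by (force simp: not_le)
    then show ?thesis using assms C by simp
  qed
  moreover have "A \<inter> {..<k} = {a \<in> A. a < k}" for A and k :: nat by auto
  ultimately show ?thesis unfolding gale_def by auto
qed

lemma bij_betw_gale_image:
  assumes R: "finite R" and D: "D \<subseteq> R" and f: "strict_mono_on R f"
  shows "bij_betw ((`) f) (gale R D) (gale (f ` R) (f ` D))"
proof -
  have inj: "inj_on f R" using f by (rule strict_mono_on_imp_inj_on)
  have less_iff: "f a < f b \<longleftrightarrow> a < b" if "a \<in> R" "b \<in> R" for a b
    using f that by (rule strict_mono_on_less)
  have card: "card (f ` A) = card A" if "A \<subseteq> R" for A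
    using inj that by (meson card_image inj_on_subset)
  have card_less: "card {c \<in> f ` A. c < f x} = card {a \<in> A. a < x}" if "A \<subseteq> R" "x \<in> R" for A x
  proof -
    have "{c \<in> f ` A. c < f x} = f ` {a \<in> A. a < x}" using that less_iff by auto
    then show ?thesis using that by (simp add: card[of "{a \<in> A. a < x}"] subset_iff)
  qed
  have "C \<in> gale R D \<longleftrightarrow> f ` C \<in> gale (f ` R) (f ` D)" if "C \<subseteq> R" for C
    using that R D by (auto simp: gale_alt card card_less image_mono)
  note iff = this
  have "(`) f ` gale R D = gale (f ` R) (f ` D)"
  proof (intro equalityI subsetI)
    fix E assume E: "E \<in> gale (f ` R) (f ` D)"
    then obtain C where "C \<subseteq> R" "E = f ` C" by (auto simp: gale_def subset_image_iff)
    with E show "E \<in> (`) f ` gale R D" using iff by auto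
  next
    fix E assume "E \<in> (`) f ` gale R D"
    then show "E \<in> gale (f ` R) (f ` D)" using iff by (auto simp: gale_def)
  qed
  then show ?thesis
    unfolding bij_betw_def
    by (intro conjI inj_on_subset[OF inj_on_image_Pow[OF inj]]) (auto simp: gale_def)
qed

text \<open>Outside \<open>R'\<close> the sets agree, so that part contributes equally to both sides
  of every count and cancels.\<close>

lemma gale_restrict:
  assumes "finite R" "R' \<subseteq> R" "C \<subseteq> R" "D \<subseteq> R" "C - R' = D - R'"
  shows "C \<in> gale R D \<longleftrightarrow> C \<inter> R' \<in> gale R' (D \<inter> R')"
proof -
  have fin: "finite C" "finite D" using assms by (auto intro: finite_subset)
  have split: "card (A \<inter> B) = card (A \<inter> R' \<inter> B) + card ((A - R') \<inter> B)" if "finite A" for A B :: "nat set"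
    using that by (subst card_Un_disjoint[symmetric]) (auto intro: arg_cong[where f = card])
  have "card C = card D \<longleftrightarrow> card (C \<inter> R') = card (D \<inter> R')"
    using split[OF fin(1), of UNIV] split[OF fin(2), of UNIV] assms(5) by simp
  moreover have "card (D \<inter> {..<k}) \<le> card (C \<inter> {..<k}) \<longleftrightarrow>
      card (D \<inter> R' \<inter> {..<k}) \<le> card (C \<inter> R' \<inter> {..<k})" for k
    using split[OF fin(1), of "{..<k}"] split[OF fin(2), of "{..<k}"] assms(5) by simp
  ultimately show ?thesis using assms(3) by (auto simp: gale_def)
qed

text \<open>Sets on \<open>R'\<close> are completed by the fixed part \<open>D - R'\<close>, whose
  monomial will be the share of one column in \<open>cofactor\<close>.\<close>

lemma column_poly_restrict:
  assumes "finite R" "R' \<subseteq> R" "D \<subseteq> R"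
  shows "(\<Prod>i\<in>D - R'. Var i) * column_poly R' (D \<inter> R') =
    (\<Sum>C | C \<in> gale R D \<and> C - R' = D - R'. \<Prod>i\<in>C. Var i)"
  unfolding column_poly_def sum_distrib_left
proof (rule sum.reindex_bij_witness[where i = "\<lambda>C. C \<inter> R'" and j = "\<lambda>C. C \<union> (D - R')"])
  fix C assume C: "C \<in> gale R' (D \<inter> R')"
  then have sub: "C \<subseteq> R'" by (simp add: gale_def)
  then show eq: "(C \<union> (D - R')) \<inter> R' = C" by auto
  show "C \<union> (D - R') \<in> {C \<in> gale R D. C - R' = D - R'}"
    using gale_restrict[OF assms(1,2), of "C \<union> (D - R')" D] eq C sub assms by auto
  have "finite C" "finite D" using sub assms finite_subset by metis+
  then show "(\<Prod>i\<in>C \<union> (D - R'). Var i) = (\<Prod>i\<in>D - R'. Var i) * (\<Prod>i\<in>C. Var i)"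
    using sub by (subst prod.union_disjoint) (auto simp: mult.commute)
next
  fix C assume C: "C \<in> {C \<in> gale R D. C - R' = D - R'}"
  then show "C \<inter> R' \<union> (D - R') = C" by auto
  show "C \<inter> R' \<in> gale R' (D \<inter> R')"
    using gale_restrict[OF assms(1,2), of C D] C assms(3) by (auto simp: gale_def)
qed

section \<open>Subwords of a word with distinct letters\<close>

lemma subseq_imp_filter:
  assumes "distinct w" "subseq v w"
  shows "v = filter (\<lambda>x. x \<in> set v) w"
  using assms filter_in_nths subseq_conv_nths by metis

text \<open>The positions in \<open>w\<close> of the successive letters of \<open>v\<close> form a
  filtered sublist of \<open>[1..<Suc (length w)]\<close>.\<close>

lemma strict_mono_on_pos_entry:
  assumes w: "distinct w" and v: "subseq v w"
  shows "strict_mono_on {1..length v} (\<lambda>t. pos w (entry v t))"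
proof -
  have "map (pos w) v = map (pos w) (filter (\<lambda>x. x \<in> set v) (map (entry w) [1..<Suc (length w)]))"
    unfolding map_entry using subseq_imp_filter[OF w v] by metis
  also have "\<dots> = filter (\<lambda>i. entry w i \<in> set v) [1..<Suc (length w)]"
    using w by (auto simp: filter_map o_def pos_entry simp del: upt_Suc intro!: map_idI)
  finally have "sorted_wrt (<) (map (pos w) v)"
    by (metis sorted_wrt_filter sorted_wrt_upt)
  then show ?thesis
    by (auto simp: sorted_wrt_iff_nth_less strict_mono_on_def entry_def)
qed

text \<open>The map \<open>f\<close> from positions in \<open>v\<close> to those of the same letters
  in \<open>w\<close> is increasing. It carries each column of \<open>v\<close> onto the part of the
  column of \<open>w\<close> in the rows of \<open>v\<close>, and the Gale order with it.\<close>

lemma schubert_subword_eq: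
  assumes w: "distinct w" and v: "subseq v w" and av: "avoids_1432_1423 v"
  shows "schubert_subword w v =
    (\<Prod>j\<in>set v. column_poly (pos w ` set v) (column w j \<inter> pos w ` set v))"
proof -
  have v': "distinct v" "set v \<subseteq> set w"
    using w v subseq_imp_filter[OF w v] by (metis distinct_filter, metis filter_is_subset)
  define f where "f = (\<lambda>t. pos w (entry v t))"
  have f: "strict_mono_on {1..length v} f"
    unfolding f_def by (rule strict_mono_on_pos_entry[OF w v])
  have im: "f ` {1..length v} = pos w ` set v"
    unfolding f_def by (metis entry_image image_image)
  have "subst (\<lambda>t. Var (f t)) (column_poly {1..length v} (column v j)) =
      column_poly (pos w ` set v) (column w j \<inter> pos w ` set v)" if j: "j \<in> set v" for j
  proof -
    have col: "t \<in> column v j \<longleftrightarrow> f t \<in> column w j" if t: "t \<in> {1..length v}" for t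
    proof -
      have "f (pos v j) = pos w j" "pos v j \<in> {1..length v}"
        using j pos_in[OF j] by (simp_all add: f_def entry_pos)
      then have "t < pos v j \<longleftrightarrow> f t < pos w j"
        using strict_mono_on_less[OF f t] by metis
      moreover have "entry w (f t) = entry v t" "f t \<in> {1..length w}"
        using entry_in[OF t] v'(2) pos_in entry_pos by (auto simp: f_def subset_iff)
      ultimately show ?thesis using t by (simp add: column_def)
    qed
    have sub: "column v j \<subseteq> {1..length v}" by (auto simp: column_def)
    have D: "f ` column v j = column w j \<inter> pos w ` set v"
      unfolding im[symmetric] using sub col by auto
    have "subst (\<lambda>t. Var (f t)) (column_poly {1..length v} (column v j)) =
        (\<Sum>C\<in>gale {1..length v} (column v j). \<Prod>i\<in>f ` C. Var i)"
      unfolding subst_column_poly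
    proof (intro sum.cong refl)
      fix C assume "C \<in> gale {1..length v} (column v j)"
      then have "inj_on f C"
        using strict_mono_on_imp_inj_on[OF f] by (auto simp: gale_def intro: inj_on_subset)
      then show "(\<Prod>i\<in>C. Var (f i)) = (\<Prod>i\<in>f ` C. Var i)"
        by (simp add: prod.reindex)
    qed
    also have "\<dots> = column_poly (f ` {1..length v}) (f ` column v j)"
      unfolding column_poly_def
      using bij_betw_gale_image[OF _ sub f]
      by (rule sum.reindex_bij_betw) simp
    finally show ?thesis by (simp only: im D)
  qed
  then show ?thesis
    unfolding schubert_subword_def schubert_perm[OF v'(1) av] column_product_def subst_prod f_def
    by (intro prod.cong refl) blast
qed

text \<open>Grouping boxes by columns matches the product form of the Schubert polynomial. A letter
  outside \<open>v\<close> leaves its whole column, a letter of \<open>v\<close> only the rows of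
  letters outside \<open>v\<close>.\<close>

lemma cofactor_eq:
  "cofactor w v =
    (\<Prod>j=1..length w. \<Prod>i\<in>column w j - (if j \<in> set v then pos w ` set v else {}). Var i)"
proof -
  let ?E = "\<lambda>j. column w j - (if j \<in> set v then pos w ` set v else {})"
  have mem: "(i, j) \<in> rothe_diagram w - rothe_restrict w v \<longleftrightarrow> j \<in> {1..length w} \<and> i \<in> ?E j" for i j
    by (cases "j \<in> set v") (auto simp: rothe_diagram_def rothe_restrict_def column_def)
  have "rothe_diagram w - rothe_restrict w v = prod.swap ` Sigma {1..length w} ?E"
  proof (intro set_eqI)
    fix x
    show "x \<in> rothe_diagram w - rothe_restrict w v \<longleftrightarrow> x \<in> prod.swap ` Sigma {1..length w} ?E"
      by (cases x) (simp only: mem pair_in_swap_image mem_Sigma_iff)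
  qed
  then have "cofactor w v = (\<Prod>(j, i)\<in>Sigma {1..length w} ?E. Var i)"
    unfolding cofactor_def by (simp only: prod.reindex inj_swap) (auto intro!: prod.cong)
  also have "\<dots> = (\<Prod>j=1..length w. \<Prod>i\<in>?E j. Var i)"
    by (rule prod.Sigma[symmetric]) (auto simp: column_def)
  finally show ?thesis .
qed


section \<open>Inclusion and exclusion\<close>

text \<open>With \<open>?g\<close> the indicator of the complement of \<open>T\<close>, the
  condition that \<open>V\<close> contains \<open>T\<close> is the product of \<open>?g\<close> over
  \<open>W - V\<close>. The sum is thus the expansion of the product of \<open>1 - ?g x\<close> over
  \<open>W\<close>.\<close>

lemma sum_alternating_supersets:
  assumes "finite W" "T \<subseteq> W"
  shows "(\<Sum>V\<in>Pow W. (- 1) ^ (card W - card V) * (if T \<subseteq> V then 1 else 0)) =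
    (if T = W then 1 else 0 :: 'a :: comm_ring_1)"
proof -
  let ?g = "\<lambda>x. if x \<in> T then 0 else 1 :: 'a"
  have "(\<Prod>x\<in>W - V. ?g x) = (if T \<subseteq> V then 1 else 0)" if "V \<in> Pow W" for V
  proof (cases "T \<subseteq> V")
    case False
    then obtain x where "x \<in> W - V" "x \<in> T" using assms(2) by auto
    then have "(\<Prod>x\<in>W - V. ?g x) = 0" using assms(1) by (intro prod_zero) auto
    then show ?thesis using False by simp
  qed (auto intro!: prod.neutral)
  then have "(\<Sum>V\<in>Pow W. (- 1) ^ (card W - card V) * (if T \<subseteq> V then 1 else 0)) = (\<Prod>x\<in>W. 1 - ?g x)"
    unfolding prod_diff_conv_sum'[OF assms(1)] by (intro sum.cong refl) simp
  also have "\<dots> = (if T = W then 1 else 0)"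
  proof (cases "T = W")
    case False
    then obtain x where "x \<in> W" "x \<notin> T" using assms(2) by auto
    then have "(\<Prod>x\<in>W. 1 - ?g x) = 0" using assms(1) by (intro prod_zero) auto
    then show ?thesis using False by simp
  qed (auto intro!: prod.neutral)
  finally show ?thesis .
qed

section \<open>Polynomials with nonnegative coefficients\<close>

lemma nonneg_polys_sum:
  "(\<And>a. a \<in> A \<Longrightarrow> f a \<in> nonneg_polys n) \<Longrightarrow> (\<Sum>a\<in>A. f a) \<in> nonneg_polys n"
proof (induction A rule: infinite_finite_induct)
  case (insert a A)
  then show ?case
    using keys_add[of "f a" "\<Sum>a\<in>A. f a"] by (fastforce simp: nonneg_polys_def lookup_add)
qed (auto simp: nonneg_polys_def)

lemma monomial_nonneg_polys:
  assumes "Poly_Mapping.keys m \<subseteq> {1..n}"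
  shows "Poly_Mapping.single m 1 \<in> nonneg_polys n"
  using assms by (auto simp: nonneg_polys_def lookup_single when_def)

lemma prod_monomials:
  assumes "\<And>a. a \<in> A \<Longrightarrow> \<exists>m. f a = Poly_Mapping.single m 1 \<and> Poly_Mapping.keys m \<subseteq> X"
  shows "\<exists>m. (\<Prod>a\<in>A. f a :: mpoly) = Poly_Mapping.single m 1 \<and> Poly_Mapping.keys m \<subseteq> X"
  using assms
proof (induction A rule: infinite_finite_induct)
  case (insert a A)
  then obtain m m' where "f a = Poly_Mapping.single m 1" "Poly_Mapping.keys m \<subseteq> X"
    "(\<Prod>a\<in>A. f a) = Poly_Mapping.single m' 1" "Poly_Mapping.keys m' \<subseteq> X" by blast
  then show ?case
    using insert(1,2) keys_add[of m m'] by (intro exI[of _ "m + m'"]) (auto simp: mult_single)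
qed (auto intro!: exI[of _ 0])

lemma prod_Var_nonneg_polys:
  assumes "\<And>j. j \<in> J \<Longrightarrow> C j \<subseteq> {1..n}"
  shows "(\<Prod>j\<in>J. \<Prod>i\<in>C j. Var i) \<in> nonneg_polys n"
proof -
  have "\<exists>m. (\<Prod>j\<in>J. \<Prod>i\<in>C j. Var i) = Poly_Mapping.single m 1 \<and> Poly_Mapping.keys m \<subseteq> {1..n}"
  proof (intro prod_monomials)
    fix j i assume "j \<in> J" "i \<in> C j"
    then have "i \<in> {1..n}" using assms by blast
    then show "\<exists>m. Var i = Poly_Mapping.single m 1 \<and> Poly_Mapping.keys m \<subseteq> {1..n}"
      by (intro exI[of _ "Poly_Mapping.single i 1"]) (simp add: Var_def)
  qed
  then show ?thesis using monomial_nonneg_polys by force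
qed

text \<open>
  The letters a subword \<open>v\<close> must contain for the tuple \<open>C\<close> to occur in \<open>M\<^bsub>w,v\<^esub> \<SS>\<^bsub>perm v\<^esub>\<close>: the
  columns \<open>j\<close> that differ from column \<open>j\<close> of the Rothe diagram, and the letters of the rows in which they differ.
\<close>
definition moved_letters :: "nat list \<Rightarrow> (nat \<Rightarrow> nat set) \<Rightarrow> nat set" where
  "moved_letters w C =
     {a \<in> set w. C a \<noteq> column w a \<or>
        (\<exists>j\<in>set w. (pos w a \<in> C j) \<noteq> (pos w a \<in> column w j))}"

text \<open>Each column of a letter of \<open>v\<close> combines its share of the cofactor with its
  column polynomial by \<open>column_poly_restrict\<close>; any other column contributes one
  monomial. Expanding the product of these sums gives the tuples.\<close>

lemma cofactor_mult_schubert_subword: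
  assumes w: "w \<in> permutations_of_set {1..n}" and v: "subseq v w" and av: "avoids_1432_1423 v"
  shows "cofactor w v * schubert_subword w v =
    (\<Sum>C | C \<in> (\<Pi>\<^sub>E j\<in>{1..n}. gale {1..n} (column w j)) \<and> moved_letters w C \<subseteq> set v.
       \<Prod>j=1..n. \<Prod>i\<in>C j. Var i)"
proof -
  note n = permutations_of_set_atLeastAtMost[OF w]
  define V where "V = set v"
  define R where "R = pos w ` V"
  have V: "V \<subseteq> {1..n}"
    using v n(3) by (auto simp: V_def dest: list_emb_set)
  have "pos w a \<in> {1..n}" if "a \<in> V" for a
    using pos_in[of a w] that V n(1,3) by (simp add: subset_iff)
  then have R: "R \<subseteq> {1..n}" by (auto simp: R_def)
  have col: "column w j \<subseteq> {1..n}" for j by (auto simp: column_def n(1))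
  \<comment> \<open>The admissible choices in column \<open>j\<close>: changes only in the rows of
    \<open>V\<close> if \<open>j\<close> is in \<open>V\<close>, and no change otherwise.\<close>
  define B where "B j = {C \<in> gale {1..n} (column w j).
      if j \<in> V then C - R = column w j - R else C = column w j}" for j
  have B: "(\<Prod>i\<in>column w j - (if j \<in> V then R else {}). Var i) *
        (if j \<in> V then column_poly R (column w j \<inter> R) else 1) = (\<Sum>C\<in>B j. \<Prod>i\<in>C. Var i)" for j
  proof (cases "j \<in> V")
    case True
    then show ?thesis
      using column_poly_restrict[OF _ R col, of j] by (simp add: B_def)
  next
    case False
    then have "B j = {column w j}" using self_in_gale[OF col] by (auto simp: B_def)
    then show ?thesis using False by simp
  qed
  have cof: "cofactor w v = (\<Prod>j=1..n. \<Prod>i\<in>column w j - (if j \<in> V then R else {}). Var i)"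
    by (simp only: cofactor_eq n(1) V_def R_def)
  have "schubert_subword w v = (\<Prod>j\<in>V. column_poly R (column w j \<inter> R))"
    using schubert_subword_eq[OF n(2) v av] by (simp add: V_def R_def)
  also have "\<dots> = (\<Prod>j=1..n. if j \<in> V then column_poly R (column w j \<inter> R) else 1)"
    using V by (subst prod.inter_restrict[symmetric]) (auto simp: Int_absorb1)
  finally have "cofactor w v * schubert_subword w v = (\<Prod>j=1..n. \<Sum>C\<in>B j. \<Prod>i\<in>C. Var i)"
    unfolding cof by (simp only: prod.distrib[symmetric] B)
  also have "\<dots> = (\<Sum>C\<in>Pi\<^sub>E {1..n} B. \<Prod>j=1..n. \<Prod>i\<in>C j. Var i)"
    by (rule prod_sum_PiE) (simp_all add: B_def)
  also have "Pi\<^sub>E {1..n} B =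
      {C. C \<in> (\<Pi>\<^sub>E j\<in>{1..n}. gale {1..n} (column w j)) \<and> moved_letters w C \<subseteq> V}"
  proof (intro equalityI subsetI CollectI conjI)
    fix C assume C: "C \<in> Pi\<^sub>E {1..n} B"
    then have CB: "C j \<in> B j" if "j \<in> {1..n}" for j using that by (rule PiE_mem)
    show "C \<in> (\<Pi>\<^sub>E j\<in>{1..n}. gale {1..n} (column w j))"
      using C by (rule subsetD[OF PiE_mono, rotated]) (auto simp: B_def)
    fix a assume a: "a \<in> moved_letters w C"
    then have "a \<in> {1..n}" by (simp add: moved_letters_def n)
    show "a \<in> V"
    proof (rule ccontr)
      assume "a \<notin> V"
      then have "C a = column w a" using CB[OF \<open>a \<in> {1..n}\<close>] by (simp add: B_def)
      then have "\<exists>j\<in>{1..n}. (pos w a \<in> C j) \<noteq> (pos w a \<in> column w j)"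
        using a n(3) by (simp add: moved_letters_def)
      then obtain j where j: "j \<in> {1..n}" "(pos w a \<in> C j) \<noteq> (pos w a \<in> column w j)"
        by blast
      then have "pos w a \<in> R" using CB[OF j(1)] by (auto simp: B_def split: if_splits)
      \<comment> \<open>Distinct letters have distinct positions, so a row in \<open>R\<close> can
        only belong to a letter of \<open>V\<close>.\<close>
      then obtain b where "b \<in> V" "pos w a = pos w b" by (auto simp: R_def)
      then show False
        using \<open>a \<notin> V\<close> \<open>a \<in> {1..n}\<close> V n entry_pos by (metis subsetD)
    qed
  next
    fix C assume "C \<in> {C. C \<in> (\<Pi>\<^sub>E j\<in>{1..n}. gale {1..n} (column w j)) \<and> moved_letters w C \<subseteq> V}"
    then have C: "C \<in> (\<Pi>\<^sub>E j\<in>{1..n}. gale {1..n} (column w j))" and S: "moved_letters w C \<subseteq> V" by auto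
    have "C j \<in> B j" if j: "j \<in> {1..n}" for j
    proof -
      have g: "C j \<in> gale {1..n} (column w j)" using C j by (rule PiE_mem)
      have "i \<in> R" if i: "(i \<in> C j) \<noteq> (i \<in> column w j)" for i
      proof -
        have "i \<in> {1..n}" using i g col[of j] unfolding gale_def by blast
        then have e: "entry w i \<in> set w" "pos w (entry w i) = i"
          using n(1,2) by (simp_all add: entry_in pos_entry)
        then have "entry w i \<in> moved_letters w C" using i j n by (auto simp: moved_letters_def)
        then show ?thesis using S e(2) unfolding R_def by (metis imageI subsetD)
      qed
      moreover have "C j = column w j" if "j \<notin> V"
        using S that j n by (auto simp: moved_letters_def)
      ultimately show ?thesis using g by (auto simp: B_def)
    qed
    then show "C \<in> Pi\<^sub>E {1..n} B" using C by (auto simp: PiE_def)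
  qed
  finally show ?thesis by (simp only: V_def)
qed

text \<open>As the letters of \<open>w\<close> are distinct, a subword is recovered from its set of
  letters by filtering \<open>w\<close>.\<close>

lemma bij_betw_subwords:
  assumes "distinct w" "subseq u w"
  shows "bij_betw set {v. subseq u v \<and> subseq v w} {V. set u \<subseteq> V \<and> V \<subseteq> set w}"
proof (rule bij_betw_byWitness[where f' = "\<lambda>V. filter (\<lambda>x. x \<in> V) w"])
  show "\<forall>v\<in>{v. subseq u v \<and> subseq v w}. filter (\<lambda>x. x \<in> set v) w = v"
    using subseq_imp_filter[OF assms(1)] by auto
  show "set ` {v. subseq u v \<and> subseq v w} \<subseteq> {V. set u \<subseteq> V \<and> V \<subseteq> set w}"
    by (auto dest: list_emb_set)
  show "(\<lambda>V. filter (\<lambda>x. x \<in> V) w) ` {V. set u \<subseteq> V \<and> V \<subseteq> set w} \<subseteq> {v. subseq u v \<and> subseq v w}"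
  proof clarify
    fix V assume "set u \<subseteq> V"
    then have "filter (\<lambda>x. x \<in> V) u = u" by (auto intro: filter_True)
    then show "subseq u (filter (\<lambda>x. x \<in> V) w) \<and> subseq (filter (\<lambda>x. x \<in> V) w) w"
      using subseq_filter[OF assms(2), of "\<lambda>x. x \<in> V"] by simp
  qed
qed auto

theorem theorem1p2:
  fixes n :: nat and w u :: "nat list"
  assumes "w \<in> permutations_of_set {1..n}"
    and "avoids w [1, 4, 3, 2]"
    and "avoids w [1, 4, 2, 3]"
    and "subseq u w"
  shows "(\<Sum>v | subseq u v \<and> subseq v w.
            (-1) ^ (length w - length v) * cofactor w v * schubert_subword w v)
         \<in> nonneg_polys n"
proof -
  note n = permutations_of_set_atLeastAtMost[OF assms(1)]
  define P where "P = (\<Pi>\<^sub>E j\<in>{1..n}. gale {1..n} (column w j))"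
  define X :: "(nat \<Rightarrow> nat set) \<Rightarrow> mpoly" where "X C = (\<Prod>j=1..n. \<Prod>i\<in>C j. Var i)" for C
  have fin: "finite P" unfolding P_def by (intro finite_PiE) auto
  \<comment> \<open>Including \<open>set u\<close> merges the requirement that \<open>u\<close> be a
    subword with the requirement imposed by \<open>C\<close>.\<close>
  define T where "T C = set u \<union> moved_letters w C" for C
  have u: "set u \<subseteq> {1..n}" using assms(4) n(3) by (auto dest: list_emb_set)
  then have T: "T C \<subseteq> {1..n}" for C using n by (auto simp: T_def moved_letters_def)
  \<comment> \<open>The summand depends on \<open>v\<close> only through \<open>set v\<close>, so
    the sum can be moved to sets of letters.\<close>
  have "(-1) ^ (length w - length v) * cofactor w v * schubert_subword w v =
      (-1) ^ (n - card (set v)) * (\<Sum>C | C \<in> P \<and> moved_letters w C \<subseteq> set v. X C)"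
    if v: "subseq u v" "subseq v w" for v
  proof -
    have "distinct v" using subseq_imp_filter[OF n(2) v(2)] n(2) by (metis distinct_filter)
    moreover have "avoids v p" if "avoids w p" for p
      using that v(2) subseq_order.trans unfolding avoids_def by blast
    ultimately have "avoids_1432_1423 v"
      using assms(2,3) by (intro avoids_1432_1423I) auto
    then show ?thesis
      using cofactor_mult_schubert_subword[OF assms(1) v(2)] \<open>distinct v\<close> n
      by (simp add: mult.assoc P_def X_def distinct_card)
  qed
  then have "(\<Sum>v | subseq u v \<and> subseq v w.
        (-1) ^ (length w - length v) * cofactor w v * schubert_subword w v) =
      (\<Sum>v | subseq u v \<and> subseq v w.
        (-1) ^ (n - card (set v)) * (\<Sum>C | C \<in> P \<and> moved_letters w C \<subseteq> set v. X C))"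
    by (intro sum.cong) auto
  also have "\<dots> = (\<Sum>V | set u \<subseteq> V \<and> V \<subseteq> {1..n}.
        (-1) ^ (n - card V) * (\<Sum>C | C \<in> P \<and> moved_letters w C \<subseteq> V. X C))"
    using bij_betw_subwords[OF n(2) assms(4)] unfolding n(3) by (rule sum.reindex_bij_betw)
  \<comment> \<open>The sum is extended to all sets of letters: a set not containing
    \<open>set u\<close> contains no \<open>T C\<close>, so its terms vanish.\<close>
  also have "\<dots> = (\<Sum>V\<in>Pow {1..n}. \<Sum>C\<in>P.
        X C * ((-1) ^ (card {1..n} - card V) * (if T C \<subseteq> V then 1 else 0)))"
  proof (rule sum.mono_neutral_cong_left)
    fix V assume V: "V \<in> {V. set u \<subseteq> V \<and> V \<subseteq> {1..n}}"
    have "(\<Sum>C | C \<in> P \<and> moved_letters w C \<subseteq> V. X C) = (\<Sum>C\<in>P. if T C \<subseteq> V then X C else 0)"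
      using fin V by (subst sum.inter_filter[symmetric]) (auto simp: T_def)
    then show "(-1) ^ (n - card V) * (\<Sum>C | C \<in> P \<and> moved_letters w C \<subseteq> V. X C) =
        (\<Sum>C\<in>P. X C * ((-1) ^ (card {1..n} - card V) * (if T C \<subseteq> V then 1 else 0)))"
      by (auto simp: sum_distrib_left intro!: sum.cong)
  next
    show "\<forall>V\<in>Pow {1..n} - {V. set u \<subseteq> V \<and> V \<subseteq> {1..n}}.
        (\<Sum>C\<in>P. X C * ((-1) ^ (card {1..n} - card V) * (if T C \<subseteq> V then 1 else 0))) = 0"
    proof (intro ballI sum.neutral)
      fix V C assume "V \<in> Pow {1..n} - {V. set u \<subseteq> V \<and> V \<subseteq> {1..n}}"
      then have "\<not> T C \<subseteq> V" by (auto simp: T_def)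
      then show "X C * ((-1) ^ (card {1..n} - card V) * (if T C \<subseteq> V then 1 else 0)) = 0" by simp
    qed
  qed auto
  \<comment> \<open>After exchanging the sums, the inner alternating sum vanishes unless
    \<open>T C\<close> is everything, where it is 1; only monomials with coefficient 1
    remain.\<close>
  also have "\<dots> = (\<Sum>C\<in>P. X C * (if T C = {1..n} then 1 else 0))"
    unfolding sum.swap[of _ P] sum_distrib_left[symmetric]
    by (subst sum_alternating_supersets) (use T in auto)
  also have "\<dots> \<in> nonneg_polys n"
  proof (rule nonneg_polys_sum)
    fix C assume "C \<in> P"
    then have "X C \<in> nonneg_polys n"
      unfolding X_def P_def by (intro prod_Var_nonneg_polys) (auto simp: gale_def dest!: PiE_mem)
    then show "X C * (if T C = {1..n} then 1 else 0) \<in> nonneg_polys n"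
      by (auto simp: nonneg_polys_def)
  qed
  finally show ?thesis .
qed

end
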